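(* Let $(\mathfrak A,\mathfrak B)$ be an access structure on $[\mathsf n]$ and let $\Phi$ be a linear $(\mathfrak A,\mathfrak B,\mathsf n)$-CSNSS protocol over a finite field $\mathbb F_q$, given by a linear encoder $\psi:\mathbb F_q^{\mathsf x+\mathsf y}\to\mathbb F_q^{\mathsf z}$ and a position map $\tau:[\mathsf z]\to[\mathsf n]$, with SS rate $R_{\mathrm{SS}}$. Let $\mathsf G_\psi\in\mathbb F_q^{\mathsf z\times(\mathsf x+\mathsf y)}$ be the matrix representing $\psi$. Then the MMSP $(\mathsf G_\psi,\tau)$ is an $(\mathfrak A,\mathfrak B,\mathsf n)$-MMSP with MMSP rate equal to $R_{\mathrm{SS}}$.
   Context: Notation: $[n]=\{1,\dots,n\}$. For a tuple $A=(A_1,\dots,A_n)$ and $\mathcal X\subset[n]$, $A_{\mathcal X}=(A_i)_{i\in\mathcal X}$; for a matrix $\mathsf A$ with rows indexed by $[n]$, $\mathsf A_{\mathcal X}$ is the submatrix of rows indexed by $\mathcal X$. $I(\cdot;\cdot)$ is mutual information. $\mathsf n,\mathsf x,\mathsf y,\mathsf z$ are positive integers. Access structure on $[\mathsf n]$: a pair $(\mathfrak A,\mathfrak B)$ of subsets of $2^{[\mathsf n]}$ with $\mathfrak A$ closed under supersets, $\mathfrak B$ closed under subsets, and $\mathfrak A\cap\mathfrak B=\emptyset$. Linear NSS protocol over $\mathbb F_q$ given by a linear map $\psi:\mathbb F_q^{\mathsf x+\mathsf y}\to\mathbb F_q^{\mathsf z}$ and a position map $\tau:[\mathsf z]\to[\mathsf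 n]$: the secret $L\in\mathbb F_q^{\mathsf x}$ and the dealer's randomness $U\in\mathbb F_q^{\mathsf y}$ are independent and uniform; with $(Z_1,\dots,Z_{\mathsf z})=\psi(L,U)$, the $j$-th share is $S_j=(Z_i)_{i\in\tau^{-1}(j)}\in\mathbb F_q^{|\tau^{-1}(j)|}$. It is an $(\mathfrak A,\mathfrak B,\mathsf n)$-CSNSS (completely secure) protocol if for every $\mathcal A\in\mathfrak A$ the maximum likelihood decoder of $L$ from $S_{\mathcal A}$ has error probability $0$ (i.e. $L$ is a function of $S_{\mathcal A}$), and $I(L;S_{\mathcal B})=0$ for every $\mathcal B\in\mathfrak B$. Its SS rate (size in $\log$ of the secret divided by total size in $\log$ of the shares) is $\mathsf x/\mathsf z$. MMSP (multi-target monotone span program): a pair $(\mathsf G,\tau)$ with $\mathsf G\in\mathbb F_q^{\mathsf z\times(\mathsf x+\mathsf y)}$ and $\tau:[\mathsf z]\to[\mathsf n]$. Let $\mathcal E=\{\mathbf e_1,\dots,\mathbf e_{\mathsf x}\}$ be the first $\mathsf x$ standard basis row vectors of $\mathbb F_q^{\mathsf x+\mathsf y}$. It is an $(\mathfrak A,\mathfrak B,\mathsf n)$-MMSP if $\mathcal E\subset\operatorname{rowspan}\mathsf G_{\tau^{-1}(\mathcal A)}$ for all $\mathcal A\in\mathfrak A$ (it accepts $\mathfrak A$), and $\operatorname{span}\mathcal E\cap\operatorname{rowspan}\mathsf G_{\tau^{-1}(\mathcal B)}=\{0\}$ for all $\mathcal B\in\mathfrak B$ (it rejects $\mathfrak B$).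 The MMSP rate is $\mathsf x/\mathsf z$. *)

theory Defs
  imports "HOL-Probability.Probability"
begin

text \<open>
  The index sets of size n, x, y and z are the universes of finite types 'n, 'x, 'y and 'z,
  \<open>F\<^sub>q\<close> is an arbitrary type of class \<open>field\<close> and \<open>finite\<close>, and the first x of the
  x + y coordinates are the \<^const>\<open>Inl\<close> coordinates of the sum type \<open>'x + 'y\<close>.
\<close>

definition access_structure :: "'n::finite set set \<Rightarrow> 'n set set \<Rightarrow> bool" where
  "access_structure \<AA> \<BB> \<longleftrightarrow>
     (\<forall>A\<in>\<AA>. \<forall>A'. A \<subseteq> A' \<longrightarrow> A' \<in> \<AA>) \<and>
     (\<forall>B\<in>\<BB>. \<forall>B'. B' \<subseteq> B \<longrightarrow> B' \<in> \<BB>) \<and>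
     \<AA> \<inter> \<BB> = {}"

definition vec_append :: "'a ^ 'x \<Rightarrow> 'a ^ 'y \<Rightarrow> 'a ^ ('x::finite + 'y::finite)" where
  "vec_append l u = (\<chi> k. case k of Inl i \<Rightarrow> l $ i | Inr j \<Rightarrow> u $ j)"

text \<open>Sample space of the protocol: pairs (secret, randomness), uniform and independent.\<close>

definition dealer :: "((('a::{field,finite}) ^ 'x) \<times> ('a ^ 'y)) pmf" where
  "dealer = pair_pmf (pmf_of_set UNIV) (pmf_of_set UNIV)"

text \<open>
  Families such as \<open>(Z\<^sub>i)\<close> for i in I, and \<open>(S\<^sub>j)\<close> for j in J, are functions that are
  \<^const>\<open>undefined\<close> outside their index set.
\<close>

definition share_space :: "('z \<Rightarrow> 'n) \<Rightarrow> 'n \<Rightarrow> ('z \<Rightarrow> 'a) set" where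
  "share_space \<tau> j = (\<Pi>\<^sub>E i \<in> \<tau> -` {j}. UNIV)"

definition share ::
  "('a ^ ('x::finite + 'y::finite) \<Rightarrow> 'a ^ 'z) \<Rightarrow> ('z \<Rightarrow> 'n) \<Rightarrow> 'n \<Rightarrow> ('a ^ 'x) \<times> ('a ^ 'y) \<Rightarrow> ('z \<Rightarrow> 'a)" where
  "share \<psi> \<tau> j = (\<lambda>(l, u). \<lambda>i \<in> \<tau> -` {j}. \<psi> (vec_append l u) $ i)"

definition shares ::
  "('a ^ ('x::finite + 'y::finite) \<Rightarrow> 'a ^ 'z) \<Rightarrow> ('z \<Rightarrow> 'n) \<Rightarrow> 'n set \<Rightarrow> ('a ^ 'x) \<times> ('a ^ 'y) \<Rightarrow> ('n \<Rightarrow> 'z \<Rightarrow> 'a)" where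
  "shares \<psi> \<tau> J \<omega> = (\<lambda>j \<in> J. share \<psi> \<tau> j \<omega>)"

text \<open>Ties between maximisers are broken by \<^const>\<open>arg_max\<close>.\<close>

definition ml_decoder :: "'w pmf \<Rightarrow> ('w \<Rightarrow> 'l) \<Rightarrow> ('w \<Rightarrow> 's) \<Rightarrow> 's \<Rightarrow> 'l" where
  "ml_decoder p L S s = arg_max (\<lambda>l. \<P>(\<omega> in measure_pmf p. S \<omega> = s \<bar> L \<omega> = l)) (\<lambda>_. True)"

definition ml_error_prob :: "'w pmf \<Rightarrow> ('w \<Rightarrow> 'l) \<Rightarrow> ('w \<Rightarrow> 's) \<Rightarrow> real" where
  "ml_error_prob p L S = \<P>(\<omega> in measure_pmf p. ml_decoder p L S (S \<omega>) \<noteq> L \<omega>)"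

definition mutual_info :: "'w pmf \<Rightarrow> ('w \<Rightarrow> 'l) \<Rightarrow> ('w \<Rightarrow> 's) \<Rightarrow> real" where
  "mutual_info p L S =
     prob_space.mutual_information (measure_pmf p) 2 (count_space (range L)) (count_space (range S)) L S"

definition linear_csnss ::
  "'n::finite set set \<Rightarrow> 'n set set \<Rightarrow> (('a::{field,finite}) ^ ('x::finite + 'y::finite) \<Rightarrow> 'a ^ 'z) \<Rightarrow> ('z \<Rightarrow> 'n) \<Rightarrow> bool" where
  "linear_csnss \<AA> \<BB> \<psi> \<tau> \<longleftrightarrow>
     Vector_Spaces.linear (*s) (*s) \<psi> \<and>
     (\<forall>A\<in>\<AA>. ml_error_prob dealer fst (shares \<psi> \<tau> A) = 0) \<and>
     (\<forall>B\<in>\<BB>. mutual_info dealer fst (shares \<psi> \<tau> B) = 0)"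

text \<open>Logarithmic size of the secret over the total logarithmic size of the shares.\<close>

definition ss_rate ::
  "(('a::{field,finite}) ^ ('x::finite + 'y::finite) \<Rightarrow> 'a ^ 'z) \<Rightarrow> ('z \<Rightarrow> 'n::finite) \<Rightarrow> real" where
  "ss_rate \<psi> \<tau> =
     log 2 (card (UNIV :: ('a ^ 'x) set)) /
     (\<Sum>j\<in>UNIV. log 2 (card (share_space \<tau> j :: ('z \<Rightarrow> 'a) set)))"


text \<open>Row span of the submatrix of the rows indexed by I.\<close>

definition rowspan_on :: "('a::field) ^ 'c ^ 'z \<Rightarrow> 'z set \<Rightarrow> ('a ^ 'c) set" where
  "rowspan_on G I = vec.span ((\<lambda>i. row i G) ` I)"

definition target_vectors :: "(('a::field) ^ ('x::finite + 'y::finite)) set" where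
  "target_vectors = range (\<lambda>i::'x. axis (Inl i) 1)"

definition mmsp ::
  "'n set set \<Rightarrow> 'n set set \<Rightarrow> ('a::field) ^ ('x::finite + 'y::finite) ^ 'z \<Rightarrow> ('z \<Rightarrow> 'n) \<Rightarrow> bool" where
  "mmsp \<AA> \<BB> G \<tau> \<longleftrightarrow>
     (\<forall>A\<in>\<AA>. target_vectors \<subseteq> rowspan_on G (\<tau> -` A)) \<and>
     (\<forall>B\<in>\<BB>. vec.span target_vectors \<inter> rowspan_on G (\<tau> -` B) = {0})"

definition mmsp_rate :: "'a ^ ('x::finite + 'y::finite) ^ 'z \<Rightarrow> ('z \<Rightarrow> 'n) \<Rightarrow> real" where
  "mmsp_rate G \<tau> = real CARD('x) / real CARD('z)"

end

theory Submission
  imports Defs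
begin

text \<open>
  All outcomes of the dealer have positive probability. Zero decoding error hence means that
  shares which agree come from equal secrets, that is, every vector in the kernel of the
  rows belonging to \<open>A\<close> has vanishing secret part; by duality the target vectors lie in the
  span of these rows. Zero mutual information means independence, so every secret is compatible
  with every value of the shares of \<open>B\<close>: for each secret \<open>l\<close> there is some \<open>u\<close> such that \<open>(l, u)\<close> is
  in the kernel of the rows belonging to \<open>B\<close>. A vector in both spans is orthogonal to all these
  \<open>(l, u)\<close> and supported on the secret coordinates, hence zero.
\<close>

section \<open>Consequences of zero mutual information and zero decoding error\<close>

lemma measure_pmf_prob_pos: "\<omega> \<in> set_pmf p \<Longrightarrow> \<omega> \<in> A \<Longrightarrow> measure_pmf.prob p A > 0"
  by (metis disjoint_iff measure_pmf_zero_iff zero_less_measure_iff)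

text \<open>With every set measurable, \<open>f\<close> is measurable, and on a finite space it is
  bounded by its largest absolute value.\<close>

lemma integrable_finite_space:
  fixes f :: "'a \<Rightarrow> real"
  assumes "finite_measure M" "finite (space M)" "sets M = Pow (space M)"
  shows "integrable M f"
proof -
  interpret finite_measure M by fact
  have "f \<in> borel_measurable M"
    by (rule measurableI) (auto simp: assms(3))
  moreover have "AE x in M. norm (f x) \<le> Max ((\<lambda>x. norm (f x)) ` space M)"
    using assms(2) by (intro AE_I2 Max_ge) auto
  ultimately show ?thesis
    by (intro integrable_const_bound)
qed

text \<open>Mutual information is the KL divergence of the joint law \<open>Q\<close> from the
  product \<open>P\<close> of the marginals. It vanishes only for \<open>Q = P\<close>, once
  \<open>Q\<close> is absolutely continuous with respect to \<open>P\<close> and the entropy density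
  is integrable.\<close>

lemma mutual_info_eq_0_imp_distr_eq_pair:
  fixes p :: "'w pmf"
  assumes fin: "finite (range L)" "finite (range S)" and zero: "mutual_info p L S = 0"
  shows "distr (measure_pmf p) (count_space (range L) \<Otimes>\<^sub>M count_space (range S)) (\<lambda>\<omega>. (L \<omega>, S \<omega>)) =
    distr (measure_pmf p) (count_space (range L)) L \<Otimes>\<^sub>M distr (measure_pmf p) (count_space (range S)) S"
proof -
  let ?A = "count_space (range L)" and ?B = "count_space (range S)"
  define P where "P = distr (measure_pmf p) ?A L \<Otimes>\<^sub>M distr (measure_pmf p) ?B S"
  define Q where "Q = distr (measure_pmf p) (?A \<Otimes>\<^sub>M ?B) (\<lambda>\<omega>. (L \<omega>, S \<omega>))"
  have prod: "?A \<Otimes>\<^sub>M ?B = count_space (range L \<times> range S)"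
    using fin by (rule pair_measure_count_space)
  have meas: "L \<in> measurable (measure_pmf p) ?A" "S \<in> measurable (measure_pmf p) ?B"
    "(\<lambda>\<omega>. (L \<omega>, S \<omega>)) \<in> measurable (measure_pmf p) (?A \<Otimes>\<^sub>M ?B)"
    unfolding prod by auto
  interpret X: prob_space "distr (measure_pmf p) ?A L"
    using meas by (intro measure_pmf.prob_space_distr)
  interpret Y: prob_space "distr (measure_pmf p) ?B S"
    using meas by (intro measure_pmf.prob_space_distr)
  interpret XY: pair_prob_space "distr (measure_pmf p) ?A L" "distr (measure_pmf p) ?B S" ..
  interpret P: information_space P 2
    unfolding P_def by unfold_locales simp
  interpret Q: prob_space Q
    unfolding Q_def using meas by (intro measure_pmf.prob_space_distr)
  have sets_P: "sets P = Pow (range L \<times> range S)"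
  proof -
    have "sets P = sets (?A \<Otimes>\<^sub>M ?B)"
      unfolding P_def by (intro sets_pair_measure_cong) auto
    then show ?thesis unfolding prod by simp
  qed
  have sets_Q: "sets Q = Pow (range L \<times> range S)"
    unfolding Q_def prod by simp
  \<comment> \<open>At an outcome of the support both marginals have positive mass, so the point
    \<open>(L \<omega>, S \<omega>)\<close> has positive mass under \<open>P\<close>. A
    \<open>P\<close>-null set therefore misses all these points, which carry all of
    \<open>Q\<close>.\<close>
  have "absolutely_continuous P Q"
    unfolding absolutely_continuous_def
  proof
    fix N assume N: "N \<in> null_sets P"
    then have sub: "N \<subseteq> range L \<times> range S"
      using sets_P by auto
    have "(L \<omega>, S \<omega>) \<notin> N" if \<omega>: "\<omega> \<in> set_pmf p" for \<omega>
    proof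
      assume "(L \<omega>, S \<omega>) \<in> N"
      then have "emeasure P ({L \<omega>} \<times> {S \<omega>}) \<le> emeasure P N"
        using N by (intro emeasure_mono) auto
      moreover have "emeasure P ({L \<omega>} \<times> {S \<omega>}) =
          ennreal (measure_pmf.prob p (L -` {L \<omega>})) * ennreal (measure_pmf.prob p (S -` {S \<omega>}))"
        unfolding P_def using meas
        by (subst Y.emeasure_pair_measure_Times) (auto simp: emeasure_distr measure_pmf.emeasure_eq_measure)
      moreover have "measure_pmf.prob p (L -` {L \<omega>}) > 0" "measure_pmf.prob p (S -` {S \<omega>}) > 0"
        using \<omega> by (auto intro: measure_pmf_prob_pos)
      ultimately show False
        using N by (auto simp: null_sets_def ennreal_mult[symmetric] ennreal_eq_0_iff zero_less_mult_iff
          simp flip: not_less)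
    qed
    then have "emeasure Q N = 0"
      using sub meas unfolding Q_def prod
      by (subst emeasure_distr) (auto simp: measure_pmf.emeasure_eq_measure measure_pmf_zero_iff)
    then show "N \<in> null_sets Q"
      using sub by (auto simp: null_sets_def sets_Q)
  qed
  moreover have "integrable Q (entropy_density 2 P Q)"
    by (rule integrable_finite_space) (use fin in \<open>auto simp: Q_def prod intro: Q.finite_measure_axioms[unfolded Q_def prod]\<close>)
  moreover have "KL_divergence 2 P Q = 0"
    using zero by (simp add: mutual_info_def prob_space.mutual_information_def[OF measure_pmf.prob_space_axioms] P_def Q_def)
  moreover have "sets Q = sets P"
    by (simp only: sets_P sets_Q)
  ultimately have "Q = P"
    using P.KL_eq_0_iff_eq_ac[of Q] Q.prob_space_axioms by simp
  then show ?thesis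
    by (simp only: P_def Q_def)
qed

text \<open>By independence the event that \<open>L\<close> has its value at the first outcome and
  \<open>S\<close> its value at the second has as probability a product of two positive numbers, so
  it meets the support.\<close>

lemma mutual_info_eq_0_compatible:
  assumes fin: "finite (range L)" "finite (range S)" and zero: "mutual_info p L S = 0"
    and \<omega>: "\<omega>\<^sub>1 \<in> set_pmf p" "\<omega>\<^sub>2 \<in> set_pmf p"
  obtains \<omega> where "\<omega> \<in> set_pmf p" "L \<omega> = L \<omega>\<^sub>1" "S \<omega> = S \<omega>\<^sub>2"
proof -
  let ?A = "count_space (range L)" and ?B = "count_space (range S)"
  have prod: "?A \<Otimes>\<^sub>M ?B = count_space (range L \<times> range S)"
    using fin by (rule pair_measure_count_space)
  interpret Y: prob_space "distr (measure_pmf p) ?B S"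
    by (rule measure_pmf.prob_space_distr) simp
  have "ennreal (measure_pmf.prob p {\<omega>. L \<omega> = L \<omega>\<^sub>1 \<and> S \<omega> = S \<omega>\<^sub>2}) =
      emeasure (distr (measure_pmf p) (?A \<Otimes>\<^sub>M ?B) (\<lambda>\<omega>. (L \<omega>, S \<omega>))) ({L \<omega>\<^sub>1} \<times> {S \<omega>\<^sub>2})"
    unfolding prod
    by (subst emeasure_distr) (auto simp: measure_pmf.emeasure_eq_measure vimage_def)
  also have "\<dots> = ennreal (measure_pmf.prob p (L -` {L \<omega>\<^sub>1})) * ennreal (measure_pmf.prob p (S -` {S \<omega>\<^sub>2}))"
    unfolding mutual_info_eq_0_imp_distr_eq_pair[OF fin zero]
    by (subst Y.emeasure_pair_measure_Times)
      (auto simp: emeasure_distr measure_pmf.emeasure_eq_measure)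
  also have "\<dots> > 0"
    using measure_pmf_prob_pos[OF \<omega>(1), of "L -` {L \<omega>\<^sub>1}"]
      measure_pmf_prob_pos[OF \<omega>(2), of "S -` {S \<omega>\<^sub>2}"]
    by (simp add: ennreal_zero_less_mult_iff)
  finally show ?thesis
    using that by (auto simp: measure_pmf_zero_iff zero_less_measure_iff)
qed

text \<open>The decoder sees only the value of \<open>S\<close>, and with zero error it returns the
  value of \<open>L\<close> at every outcome of the support.\<close>

lemma ml_error_prob_eq_0_imp_determined:
  assumes "ml_error_prob p L S = 0" "\<omega> \<in> set_pmf p" "\<omega>' \<in> set_pmf p" "S \<omega> = S \<omega>'"
  shows "L \<omega> = L \<omega>'"
proof -
  have "ml_decoder p L S (S \<omega>) = L \<omega>" if "\<omega> \<in> set_pmf p" for \<omega>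
    using assms(1) that by (auto simp: ml_error_prob_def measure_pmf_zero_iff)
  then show ?thesis
    using assms(2-4) by metis
qed

section \<open>The dealer's outcomes and the equality of shares\<close>

lemma set_pmf_dealer [simp]: "set_pmf dealer = UNIV"
  by (simp add: dealer_def)

lemma vec_append_diff: "vec_append l u - vec_append l' u' = vec_append (l - l') (u - u')"
  by (simp add: vec_append_def vec_eq_iff split: sum.split)

lemma vec_append_surj: obtains l u where "v = vec_append l u"
proof
  show "v = vec_append (\<chi> i. v $ Inl i) (\<chi> j. v $ Inr j)"
    by (simp add: vec_append_def vec_eq_iff split: sum.split)
qed

text \<open>Off their index sets both families are \<open>undefined\<close>, so they can differ only
  at coordinates whose position lies in \<open>J\<close>.\<close>

lemma shares_eq_iff:
  "shares \<psi> \<tau> J (l, u) = shares \<psi> \<tau> J (l', u') \<longleftrightarrow>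
    (\<forall>i\<in>\<tau> -` J. \<psi> (vec_append l u) $ i = \<psi> (vec_append l' u') $ i)"
  unfolding shares_def share_def fun_eq_iff restrict_def by auto

section \<open>Duality between row span and kernel\<close>

lemma rowspan_on_orthogonal:
  assumes w: "w \<in> rowspan_on G I" and v: "\<And>i. i \<in> I \<Longrightarrow> (G *v v) $ i = 0"
  shows "(\<Sum>k\<in>UNIV. w $ k * v $ k) = 0"
  using w unfolding rowspan_on_def
proof (induction rule: vec.span_induct_alt)
  case base
  then show ?case by simp
next
  case (step c x y)
  then have "(\<Sum>k\<in>UNIV. x $ k * v $ k) = 0"
    using v by (auto simp: row_def matrix_vector_mult_def)
  moreover have "(\<Sum>k\<in>UNIV. (c *s x + y) $ k * v $ k) =
      c * (\<Sum>k\<in>UNIV. x $ k * v $ k) + (\<Sum>k\<in>UNIV. y $ k * v $ k)"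
    by (simp add: algebra_simps sum.distrib sum_distrib_left)
  ultimately show ?case
    using step by simp
qed

text \<open>A vector \<open>w\<close> outside the row span extends a basis \<open>B\<close> of that
  span to an independent set. So some linear functional vanishes on all the rows but not at
  \<open>w\<close>, and the vector representing it contradicts \<open>orth\<close>.\<close>

lemma mem_rowspan_on_if_orthogonal:
  fixes G :: "'a::field ^ 'c ^ 'z"
  assumes orth: "\<And>v. (\<And>i. i \<in> I \<Longrightarrow> (G *v v) $ i = 0) \<Longrightarrow> (\<Sum>k\<in>UNIV. w $ k * v $ k) = 0"
  shows "w \<in> rowspan_on G I"
proof (rule ccontr)
  assume w: "w \<notin> rowspan_on G I"
  obtain B where B: "B \<subseteq> (\<lambda>i. row i G) ` I" "vec.independent B"
    and span: "(\<lambda>i. row i G) ` I \<subseteq> vec.span B"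
    using vec.maximal_independent_subset by blast
  have wB: "w \<notin> vec.span B"
    using w vec.span_mono[OF B(1)] by (auto simp: rowspan_on_def)
  then have "vec.independent (insert w B)"
    using B(2) by (simp add: vec.independent_insert)
  \<comment> \<open>The map \<open>g\<close> is vector-valued and sends \<open>w\<close> to the
    all-ones vector, so each coordinate of \<open>g\<close> is a functional as wanted. An arbitrary
    coordinate \<open>k0\<close> is used, represented by row \<open>k0\<close> of the matrix of
    \<open>g\<close>.\<close>
  then obtain g :: "'a ^ 'c \<Rightarrow> 'a ^ 'c" where g: "Vector_Spaces.linear (*s) (*s) g"
    and gB: "\<forall>x\<in>insert w B. g x = (if x = w then 1 else 0)"
    using vec.linear_independent_extend[of "insert w B" "\<lambda>x. if x = w then 1 else 0"] by blast
  interpret g: Vector_Spaces.linear "(*s)" "(*s)" g by fact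
  fix k0 :: 'c
  define v where "v = row k0 (matrix g)"
  have gv: "g x $ k0 = (\<Sum>k\<in>UNIV. x $ k * v $ k)" for x
    by (subst matrix_works[OF g, symmetric]) (simp add: v_def row_def matrix_vector_mult_def mult.commute)
  have "g x = 0" if "x \<in> vec.span B" for x
  proof (rule g.eq_0_on_span[OF _ that])
    show "g b = 0" if "b \<in> B" for b
      using that gB wB vec.span_base by auto
  qed
  then have "(G *v v) $ i = 0" if "i \<in> I" for i
    using gv[of "row i G"] that span by (auto simp: row_def matrix_vector_mult_def)
  then have "g w $ k0 = 0"
    using orth gv by simp
  then show False
    using gB by simp
qed

lemma span_target_vectors_Inr:
  assumes "w \<in> vec.span target_vectors"
  shows "w $ Inr j = 0"
  using assms
  by (induction rule: vec.span_induct_alt) (auto simp: target_vectors_def axis_def)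

section \<open>From decoding and secrecy to the span conditions\<close>

lemma csnss_imp_mmsp:
  fixes \<psi> :: "('a::{field,finite}) ^ ('x::finite + 'y::finite) \<Rightarrow> 'a ^ 'z::finite"
  assumes "linear_csnss \<AA> \<BB> \<psi> \<tau>"
  shows "mmsp \<AA> \<BB> (matrix \<psi>) \<tau>"
proof -
  have lin: "Vector_Spaces.linear (*s) (*s) \<psi>"
    and err: "\<And>A. A \<in> \<AA> \<Longrightarrow> ml_error_prob dealer fst (shares \<psi> \<tau> A) = 0"
    and inf: "\<And>B. B \<in> \<BB> \<Longrightarrow> mutual_info dealer fst (shares \<psi> \<tau> B) = 0"
    using assms by (auto simp: linear_csnss_def)
  interpret \<psi>: Vector_Spaces.linear "(*s)" "(*s)" \<psi> by fact
  note mat = matrix_works[OF lin]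
  have "axis (Inl i) 1 \<in> rowspan_on (matrix \<psi>) (\<tau> -` A)" if A: "A \<in> \<AA>" for A and i :: 'x
  proof (rule mem_rowspan_on_if_orthogonal)
    fix v :: "'a ^ ('x + 'y)"
    assume v: "\<And>j. j \<in> \<tau> -` A \<Longrightarrow> (matrix \<psi> *v v) $ j = 0"
    obtain l u where lu: "v = vec_append l u" by (rule vec_append_surj)
    have "vec_append 0 0 = (0 :: 'a ^ ('x + 'y))"
      by (simp add: vec_append_def vec_eq_iff split: sum.split)
    \<comment> \<open>A kernel vector yields the same shares as the zero outcome, so its secret part
      \<open>l\<close> must be 0; the required sum is just \<open>l $ i\<close>.\<close>
    then have "shares \<psi> \<tau> A (l, u) = shares \<psi> \<tau> A (0, 0)"
      using v by (simp add: shares_eq_iff mat lu \<psi>.zero)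
    from ml_error_prob_eq_0_imp_determined[OF err[OF A] _ _ this] have "l = 0"
      by simp
    then show "(\<Sum>k\<in>UNIV. axis (Inl i) 1 $ k * v $ k) = 0"
      by (simp add: axis_def lu vec_append_def if_distrib if_distribR cong: if_cong)
  qed
  moreover have "w = 0" if B: "B \<in> \<BB>" and w: "w \<in> vec.span target_vectors"
    and wB: "w \<in> rowspan_on (matrix \<psi>) (\<tau> -` B)" for B w
  proof -
    have "w $ Inl i = 0" for i
    proof -
      \<comment> \<open>The shares produced by the \<open>i\<close>-th unit secret also arise from
        the secret 0. The difference of the two inputs is a kernel vector \<open>v\<close> whose
        secret part is that unit vector.\<close>
      obtain \<omega> where \<omega>: "fst \<omega> = fst (0 :: 'a ^ 'x, 0 :: 'a ^ 'y)"
        "shares \<psi> \<tau> B \<omega> = shares \<psi> \<tau> B (axis i 1, 0)"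
        using mutual_info_eq_0_compatible[OF _ _ inf[OF B], of "(0, 0)" "(axis i 1, 0)"] by auto
      define v where "v = vec_append (axis i 1) 0 - vec_append 0 (snd \<omega>)"
      have "shares \<psi> \<tau> B (0, snd \<omega>) = shares \<psi> \<tau> B (axis i 1, 0)"
        using \<omega> by (metis fst_conv prod.collapse)
      then have "(matrix \<psi> *v v) $ j = 0" if "j \<in> \<tau> -` B" for j
        using that by (simp add: shares_eq_iff mat v_def \<psi>.diff)
      then have "(\<Sum>k\<in>UNIV. w $ k * v $ k) = 0"
        by (rule rowspan_on_orthogonal[OF wB])
      \<comment> \<open>The randomness part of \<open>v\<close> is unknown but meets only zero
        entries of \<open>w\<close>, so the orthogonality relation isolates
        \<open>w $ Inl i\<close>.\<close>
      moreover have "w $ k * v $ k = (if k = Inl i then w $ Inl i else 0)" for k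
        using span_target_vectors_Inr[OF w]
        by (cases k) (auto simp: v_def vec_append_def axis_def)
      ultimately show ?thesis
        by simp
    qed
    then show "w = 0"
      using span_target_vectors_Inr[OF w]
      unfolding vec_eq_iff zero_index by (metis sum.exhaust)
  qed
  ultimately show ?thesis
    unfolding mmsp_def by (auto simp: target_vectors_def rowspan_on_def vec.span_zero)
qed

section \<open>The rate\<close>

lemma card_share_space:
  fixes \<tau> :: "'z::finite \<Rightarrow> 'n"
  shows "card (share_space \<tau> j :: ('z \<Rightarrow> 'a::finite) set) = CARD('a) ^ card (\<tau> -` {j})"
  unfolding share_space_def by (simp add: card_PiE)

text \<open>The fibres of \<open>\<tau>\<close> partition the row indices, so the logarithmic share
  sizes add up to \<open>CARD('z)\<close> times \<open>log 2 CARD('a)\<close>. This logarithm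
  cancels against the one in the secret size; it is nonzero because a field has at least the two
  elements 0 and 1.\<close>

lemma ss_rate_eq:
  fixes \<psi> :: "('a::{field,finite}) ^ ('x::finite + 'y::finite) \<Rightarrow> 'a ^ 'z::finite"
    and \<tau> :: "'z \<Rightarrow> 'n::finite"
  shows "ss_rate \<psi> \<tau> = real CARD('x) / real CARD('z)"
proof -
  have "card {0, 1 :: 'a} \<le> CARD('a)"
    by (rule card_mono) auto
  then have q: "CARD('a) > 1"
    by simp
  have "(\<Sum>j\<in>UNIV. card (\<tau> -` {j})) = card (\<Union>j\<in>UNIV. \<tau> -` {j})"
    by (rule card_UN_disjoint[symmetric]) auto
  also have "(\<Union>j\<in>UNIV. \<tau> -` {j}) = UNIV"
    by auto
  finally have "(\<Sum>j\<in>UNIV. real (card (\<tau> -` {j}))) = real CARD('z)"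
    by (simp flip: of_nat_sum)
  then have "(\<Sum>j\<in>UNIV. log 2 (card (share_space \<tau> j :: ('z \<Rightarrow> 'a) set))) =
      real CARD('z) * log 2 CARD('a)"
    using q by (simp add: card_share_space log_nat_power flip: sum_distrib_right)
  moreover have "log 2 (real CARD('a)) \<noteq> 0"
    using q zero_less_log_cancel_iff[of 2 "real CARD('a)"] by linarith
  ultimately show ?thesis
    using q by (simp add: ss_rate_def log_nat_power)
qed

theorem theorem3:
  fixes \<AA> \<BB> :: "'n::finite set set"
    and \<psi> :: "('a::{field,finite}) ^ ('x::finite + 'y::finite) \<Rightarrow> 'a ^ 'z::finite"
    and \<tau> :: "'z \<Rightarrow> 'n"
  assumes "access_structure \<AA> \<BB>"
    and "linear_csnss \<AA> \<BB> \<psi> \<tau>"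
  shows "mmsp \<AA> \<BB> (matrix \<psi>) \<tau> \<and> mmsp_rate (matrix \<psi>) \<tau> = ss_rate \<psi> \<tau>"
  using csnss_imp_mmsp[OF assms(2)] by (simp add: mmsp_rate_def ss_rate_eq)

end
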